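(* Let $\nu$ be a non-degenerate probability measure concentrated on $\mathbb{R}_+=[0,+\infty)$, with mean $m_0(\nu)=\int x\,\nu(dx)\in(0,+\infty]$, and let $\mathbb{V}_\nu$ be the pseudo-variance function of the Cauchy-Stieltjes kernel family $\mathcal{K}_-(\nu)$. Let $\alpha>0$ be such that the free multiplicative convolution power $\nu^{\boxtimes\alpha}$ is defined. Then: (i) $m_-(\nu^{\boxtimes\alpha})=(m_-(\nu))^{\alpha}$ and $m_0(\nu^{\boxtimes\alpha})=(m_0(\nu))^{\alpha}$, and for all $m\in(m_-(\nu^{\boxtimes\alpha}),m_0(\nu^{\boxtimes\alpha}))$, $$\mathbb{V}_{\nu^{\boxtimes\alpha}}(m)=m^{2-2/\alpha}\,\mathbb{V}_\nu\left(m^{1/\alpha}\right).$$ (ii) If $m_0=m_0(\nu)<+\infty$, then the variance functions $V_\nu$ and $V_{\nu^{\boxtimes\alpha}}$ of the families $\mathcal{K}_-(\nu)$ and $\mathcal{K}_-(\nu^{\boxtimes\alpha})$ exist and, for all $m\in(m_-(\nu^{\boxtimes\alpha}),m_0(\nu^{\boxtimes\alpha}))$, $$V_{\nu^{\boxtimes\alpha}}(m)=\frac{m-m_0^{\alpha}}{m^{1/\alpha}-m_0}\,m^{1-1/\alpha}\,V_\nu\left(m^{1/\alpha}\right).$$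
   Context: CSK families. Let $\nu$ be a non-degenerate (not a Dirac mass) probability measure on $\mathbb{R}_+=[0,+\infty)$. For $\theta\in(-\infty,0)$ let $M_\nu(\theta)=\int\frac{1}{1-\theta x}\nu(dx)$ and $P_{(\theta,\nu)}(dx)=\frac{1}{M_\nu(\theta)(1-\theta x)}\nu(dx)$. The (left-sided) Cauchy-Stieltjes kernel (CSK) family generated by $\nu$ is $\mathcal{K}_-(\nu)=\{P_{(\theta,\nu)}:\theta\in(-\infty,0)\}$. The mean map $k_\nu(\theta)=\int xP_{(\theta,\nu)}(dx)=\frac{M_\nu(\theta)-1}{\theta M_\nu(\theta)}$ is strictly increasing on $(-\infty,0)$; its image is the domain of means $(m_-(\nu),m_0(\nu))$, where $m_0(\nu)=\lim_{\theta\to0^-}k_\nu(\theta)=\int x\,\nu(dx)\in(0,+\infty]$ and $m_-(\nu)=\lim_{\theta\to-\infty}k_\nu(\theta)=-1/G_\nu(0)=\left(\int x^{-1}\nu(dx)\right)^{-1}\ge 0$ (equal to $0$ if $\int x^{-1}\nu(dx)=+\infty$), with $G_\nu(z)=\int\frac{1}{z-x}\nu(dx)$. Let $\psi_\nu:(m_-(\nu),m_0(\nu))\to(-\infty,0)$ be the inverse of $k_\nu$ and $Q_{(m,\nu)}=P_{(\psi_\nu(m),\nu)}$, the element of the family with mean $m$. The pseudo-variance function $\mathbb{V}_\nu$ is defined on $(m_-(\nu),m_0(\nu))$ by $\frac{\mathbb{V}_\nu(m)}{m}=\frac{1}{\psi_\nu(m)}-m$. The variance function is $V_\nu(m)=\int(x-m)^2Q_{(m,\nu)}(dx)$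 (said to exist when this is finite). $S$-transform and $\boxtimes$. Let $\delta=\nu(\{0\})<1$ and $\Psi_\nu(z)=\int_0^{+\infty}\frac{zx}{1-zx}\nu(dx)$ for $z\in\mathbb{C}\setminus\mathbb{R}_+$. $\Psi_\nu$ is univalent on the open left half-plane $i\mathbb{C}^+$ and $\Psi_\nu(i\mathbb{C}^+)\cap\mathbb{R}=(\delta-1,0)$. Let $\chi_\nu:\Psi_\nu(i\mathbb{C}^+)\to i\mathbb{C}^+$ be the inverse of $\Psi_\nu$; the $S$-transform of $\nu$ is $S_\nu(z)=\chi_\nu(z)\frac{1+z}{z}$. The free multiplicative convolution of $\nu_1,\nu_2$ is the probability measure $\nu_1\boxtimes\nu_2$ on $\mathbb{R}_+$ with $S_{\nu_1\boxtimes\nu_2}=S_{\nu_1}S_{\nu_2}$. The power $\nu^{\boxtimes\alpha}$ is the probability measure on $\mathbb{R}_+$ (when it exists; it exists at least for all $\alpha\ge1$) with $S_{\nu^{\boxtimes\alpha}}(z)=S_\nu(z)^\alpha$ for $z\in(\delta-1,0)$. *)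

theory Defs
  imports "HOL-Probability.Probability"
begin

section \<open>Cauchy-Stieltjes kernel families\<close>

text \<open>Non-degenerate Borel probability measures concentrated on the half-line from 0 to infinity.\<close>

definition nondeg_prob_nonneg :: "real measure \<Rightarrow> bool" where
  "nondeg_prob_nonneg \<nu> \<longleftrightarrow>
     prob_space \<nu> \<and> sets \<nu> = sets borel \<and> (AE x in \<nu>. 0 \<le> x) \<and> (\<forall>c. \<nu> \<noteq> return borel c)"

definition csk_M :: "real measure \<Rightarrow> real \<Rightarrow> real" where
  "csk_M \<nu> \<theta> = (\<integral>x. 1 / (1 - \<theta> * x) \<partial>\<nu>)"

definition csk_P :: "real measure \<Rightarrow> real \<Rightarrow> real measure" where
  "csk_P \<nu> \<theta> = density \<nu> (\<lambda>x. ennreal (1 / (csk_M \<nu> \<theta> * (1 - \<theta> * x))))"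

definition csk_mean :: "real measure \<Rightarrow> real \<Rightarrow> real" where
  "csk_mean \<nu> \<theta> = (\<integral>x. x \<partial>csk_P \<nu> \<theta>)"

text \<open>The lower end of the domain of means is always a finite nonnegative number, whereas the
  upper end, the mean of the generating measure, may be infinite.\<close>

definition m_minus :: "real measure \<Rightarrow> real" where
  "m_minus \<nu> = Lim at_bot (csk_mean \<nu>)"

definition m_zero :: "real measure \<Rightarrow> ennreal" where
  "m_zero \<nu> = (\<integral>\<^sup>+x. ennreal x \<partial>\<nu>)"

text \<open>Every element exceeds \<open>m_minus \<nu>\<close>, hence is positive for the measures of interest, so
  nothing is lost in the truncating coercion \<open>ennreal\<close>.\<close>

definition domain_of_means :: "real measure \<Rightarrow> real set" where
  "domain_of_means \<nu> = {m. m_minus \<nu> < m \<and> ennreal m < m_zero \<nu>}"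

definition csk_psi :: "real measure \<Rightarrow> real \<Rightarrow> real" where
  "csk_psi \<nu> = the_inv_into {..<0} (csk_mean \<nu>)"

definition csk_Q :: "real measure \<Rightarrow> real \<Rightarrow> real measure" where
  "csk_Q \<nu> m = csk_P \<nu> (csk_psi \<nu> m)"

definition pseudo_variance :: "real measure \<Rightarrow> real \<Rightarrow> real" where
  "pseudo_variance \<nu> m = m * (1 / csk_psi \<nu> m - m)"

definition csk_variance :: "real measure \<Rightarrow> real \<Rightarrow> real" where
  "csk_variance \<nu> m = (\<integral>x. (x - m)\<^sup>2 \<partial>csk_Q \<nu> m)"

definition csk_variance_exists :: "real measure \<Rightarrow> bool" where
  "csk_variance_exists \<nu> \<longleftrightarrow>
     (\<forall>m\<in>domain_of_means \<nu>. integrable (csk_Q \<nu> m) (\<lambda>x. (x - m)\<^sup>2))"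

text \<open>Powers with a positive exponent on the extended nonnegative reals.\<close>

definition ennreal_powr :: "ennreal \<Rightarrow> real \<Rightarrow> ennreal" where
  "ennreal_powr x \<alpha> = (if x = \<top> then \<top> else ennreal (enn2real x powr \<alpha>))"


section \<open>The S-transform and free multiplicative convolution powers\<close>

text \<open>The open left half-plane, i.e. the open upper half-plane multiplied by the imaginary unit.\<close>

definition left_half_plane :: "complex set" where
  "left_half_plane = {z. Re z < 0}"

definition Psi_transform :: "real measure \<Rightarrow> complex \<Rightarrow> complex" where
  "Psi_transform \<nu> z = (\<integral>x. z * complex_of_real x / (1 - z * complex_of_real x) \<partial>\<nu>)"

definition S_domain :: "real measure \<Rightarrow> complex set" where
  "S_domain \<nu> = Psi_transform \<nu> ` left_half_plane"

definition chi_transform :: "real measure \<Rightarrow> complex \<Rightarrow> complex" where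
  "chi_transform \<nu> = the_inv_into left_half_plane (Psi_transform \<nu>)"

definition S_transform :: "real measure \<Rightarrow> complex \<Rightarrow> complex" where
  "S_transform \<nu> z = chi_transform \<nu> z * ((1 + z) / z)"

text \<open>\<open>\<mu>\<close> is the free multiplicative convolution power of \<open>\<nu>\<close> with exponent \<open>\<alpha>\<close>. A measure is
  determined by its S-transform, so there is at most one such \<open>\<mu>\<close>; for \<open>\<alpha> < 1\<close> there may be none.
  Since HOL functions are total, it has to be demanded separately that the S-transform of \<open>\<mu>\<close> is
  defined where it is evaluated. The S-transform of \<open>\<nu>\<close> is positive on the real interval in
  question, so the principal power below is the ordinary real one.\<close>

definition is_free_mult_power :: "real measure \<Rightarrow> real \<Rightarrow> real measure \<Rightarrow> bool" where
  "is_free_mult_power \<nu> \<alpha> \<mu> \<longleftrightarrow>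
     prob_space \<mu> \<and> sets \<mu> = sets borel \<and> (AE x in \<mu>. 0 \<le> x) \<and> measure \<mu> {0} < 1 \<and>
     (\<forall>z\<in>{measure \<nu> {0} - 1<..<0}.
        complex_of_real z \<in> S_domain \<mu> \<and>
        S_transform \<mu> (complex_of_real z) =
          S_transform \<nu> (complex_of_real z) powr complex_of_real \<alpha>)"

end

theory Submission
  imports Defs
begin

text \<open>For real \<open>\<theta> < 0\<close> the transform \<open>\<Psi>\<close> takes the value \<open>z = M(\<theta>) - 1\<close>, and \<open>S(z) = 1 / k(\<theta>)\<close>, where \<open>k\<close> is
  the mean map. So the relation between the S-transforms says: if \<open>\<theta>\<close> and \<open>t\<close> give the same
  value of \<open>M\<close> for \<open>\<nu>\<close> and for its power \<open>\<mu>\<close>, then \<open>k\<^sub>\<mu>(t) = k\<^sub>\<nu>(\<theta>)\<^sup>\<alpha>\<close>. Both variance functions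
  depend on the parameter only through \<open>z\<close>: at the mean \<open>m\<close> the pseudo-variance is \<open>m\<^sup>2 / z\<close> and
  the variance is \<open>m (m - m\<^sub>0) / z\<close>; comparing them at equal \<open>z\<close> gives the two formulas.\<close>

section \<open>Positive integrals and the intermediate value theorem on the negative axis\<close>

lemma integral_pos_if_not_AE_zero:
  fixes f :: "'a \<Rightarrow> real"
  assumes "integrable M f" "AE x in M. 0 \<le> f x" "\<not> (AE x in M. f x = 0)"
  shows "0 < integral\<^sup>L M f"
  using assms integral_nonneg_eq_0_iff_AE[of M f] integral_nonneg_AE[of f M] by fastforce

lemma one_minus_mult_ge_1: "(1::real) \<le> 1 - \<theta> * x" if "\<theta> \<le> 0" "0 \<le> x"
  using that by (simp add: mult_nonpos_nonneg)

text \<open>Serves both \<open>csk_M\<close> and \<open>csk_mean\<close>. At 0 no limit is assumed,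
  only that \<open>f\<close> exceeds \<open>y\<close> arbitrarily close to 0, because the mean map
  may tend to infinity there.\<close>

lemma IVT_negative_axis:
  fixes f :: "real \<Rightarrow> real"
  assumes "continuous_on {..<0} f" "(f \<longlongrightarrow> a) at_bot" "a < y"
    and "\<exists>\<^sub>F t in at_left 0. y < f t"
  obtains t where "t < 0" "f t = y"
proof -
  have "\<forall>\<^sub>F t in at_bot. f t < y \<and> t < 0"
    using order_tendstoD(2)[OF assms(2,3)] eventually_gt_at_bot[of 0]
    by (rule eventually_conj)
  then have "\<exists>t. f t < y \<and> t < 0"
    by (rule eventually_happens'[OF trivial_limit_at_bot_linorder])
  then obtain s where s: "s < 0" "f s < y" by blast
  have "\<exists>\<^sub>F t in at_left 0. y < f t \<and> s < t \<and> t < 0"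
    using assms(4) eventually_at_left_real[OF s(1)]
    by (auto elim!: frequently_rev_mp eventually_mono)
  then obtain t where t: "y < f t" "s < t" "t < 0"
    by (auto dest: frequently_ex)
  have "continuous_on {s..t} f"
    by (rule continuous_on_subset[OF assms(1)]) (use t in auto)
  then obtain r where "s \<le> r" "r \<le> t" "f r = y"
    using IVT'[of f s y t] s t by auto
  then show ?thesis using that[of r] t by simp
qed

section \<open>Laws on the half-line and integrals of the kernel\<close>

text \<open>These are the properties that \<open>is_free_mult_power\<close> grants to \<mu> apart
  from the S-transform relation, so the results below apply to \<mu> before it is known to be
  non-degenerate.\<close>

locale nonneg_law = prob_space \<nu> for \<nu> :: "real measure" +
  assumes sets_eq [measurable_cong, simp]: "sets \<nu> = sets borel"
    and AE_nonneg: "AE x in \<nu>. 0 \<le> x"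
    and mass_zero_less_1: "measure \<nu> {0} < 1"
begin

lemma space_eq [simp]: "space \<nu> = UNIV"
  using sets_eq_imp_space_eq[OF sets_eq] by simp

lemma not_AE_zero: "\<not> (AE x in \<nu>. x = 0)"
proof
  assume "AE x in \<nu>. x = 0"
  then have "AE x in \<nu>. x \<in> {0}" by simp
  then have "prob {0} = 1" by (subst prob_eq_1) auto
  then show False using mass_zero_less_1 by simp
qed

lemma integrable_bounded:
  fixes f :: "real \<Rightarrow> 'b::{banach,second_countable_topology}"
  assumes "f \<in> borel_measurable borel" "\<And>x. 0 \<le> x \<Longrightarrow> norm (f x) \<le> B"
  shows "integrable \<nu> f"
proof (rule integrable_const_bound)
  show "AE x in \<nu>. norm (f x) \<le> B" using AE_nonneg assms(2) by auto
qed (use assms(1) in simp)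

lemma integral_cong_nonneg:
  fixes f :: "real \<Rightarrow> 'b::{banach,second_countable_topology}"
  assumes "f \<in> borel_measurable borel" "g \<in> borel_measurable borel" "\<And>x. 0 \<le> x \<Longrightarrow> f x = g x"
  shows "integral\<^sup>L \<nu> f = integral\<^sup>L \<nu> g"
proof (rule integral_cong_AE)
  show "AE x in \<nu>. f x = g x" using AE_nonneg assms(3) by auto
qed (use assms in simp_all)

text \<open>If \<open>f\<close> vanished almost everywhere, \<nu> would be concentrated at 0, which
  the bound on the atom excludes.\<close>

lemma integral_pos:
  fixes f :: "real \<Rightarrow> real"
  assumes "integrable \<nu> f" "f 0 \<ge> 0" "\<And>x. 0 < x \<Longrightarrow> 0 < f x"
  shows "0 < integral\<^sup>L \<nu> f"
proof (rule integral_pos_if_not_AE_zero[OF assms(1)])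
  show "AE x in \<nu>. 0 \<le> f x"
    using AE_nonneg by eventually_elim (use assms in \<open>metis less_eq_real_def\<close>)
  show "\<not> (AE x in \<nu>. f x = 0)"
  proof
    assume "AE x in \<nu>. f x = 0"
    with AE_nonneg have "AE x in \<nu>. x = 0"
      by eventually_elim (use assms in \<open>metis less_eq_real_def less_irrefl\<close>)
    then show False using not_AE_zero by simp
  qed
qed

lemma kernel_bounds:
  assumes "\<theta> \<le> 0" "0 \<le> x"
  shows "0 < 1 / (1 - \<theta> * x)" "1 / (1 - \<theta> * x) \<le> (1::real)"
  using one_minus_mult_ge_1[OF assms] by auto

lemma kernel_integrable: "\<theta> \<le> 0 \<Longrightarrow> integrable \<nu> (\<lambda>x. 1 / (1 - \<theta> * x))"
  by (rule integrable_bounded[where B = 1]) (use kernel_bounds[of \<theta>] in \<open>auto simp: less_imp_le\<close>)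

lemma ratio_eq:
  fixes \<theta> x :: real
  assumes "\<theta> < 0" "0 \<le> x"
  shows "x / (1 - \<theta> * x) = (1 / (1 - \<theta> * x) - 1) / \<theta>"
  using one_minus_mult_ge_1[of \<theta> x] assms by (simp add: field_simps)

lemma ratio_integrable: "(\<theta>::real) < 0 \<Longrightarrow> integrable \<nu> (\<lambda>x. x / (1 - \<theta> * x))"
proof (rule integrable_bounded[where B = "1 / - \<theta>"])
  fix x :: real assume "\<theta> < 0" "0 \<le> x"
  with one_minus_mult_ge_1[of \<theta> x] show "norm (x / (1 - \<theta> * x)) \<le> 1 / - \<theta>"
    by (auto simp: field_simps)
qed auto

lemma ratio_integral:
  assumes "\<theta> < 0"
  shows "(\<integral>x. x / (1 - \<theta> * x) \<partial>\<nu>) = (csk_M \<nu> \<theta> - 1) / \<theta>"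
proof -
  have "(\<integral>x. x / (1 - \<theta> * x) \<partial>\<nu>) = (\<integral>x. (1 / (1 - \<theta> * x) - 1) / \<theta> \<partial>\<nu>)"
    by (rule integral_cong_nonneg) (use assms ratio_eq in auto)
  also have "\<dots> = (csk_M \<nu> \<theta> - 1) / \<theta>"
    using kernel_integrable[of \<theta>] assms by (simp add: csk_M_def prob_space[simplified])
  finally show ?thesis .
qed

section \<open>The transform \<open>M\<close> on the negative axis: monotonicity, continuity,
  range\<close>

lemma csk_M_zero: "csk_M \<nu> 0 = 1"
  using prob_space by (simp add: csk_M_def)

lemma csk_M_strict_mono:
  assumes "s < t" "t \<le> 0"
  shows "csk_M \<nu> s < csk_M \<nu> t"
proof -
  have "0 < (\<integral>x. 1 / (1 - t * x) - 1 / (1 - s * x) \<partial>\<nu>)"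
  proof (rule integral_pos)
    fix x :: real assume x: "0 < x"
    have "1 - t * x < 1 - s * x" using assms x by simp
    moreover have "1 \<le> 1 - t * x" using one_minus_mult_ge_1[of t x] assms x by simp
    ultimately have "1 / (1 - s * x) < 1 / (1 - t * x)"
      by (intro divide_strict_left_mono mult_pos_pos) auto
    then show "0 < 1 / (1 - t * x) - 1 / (1 - s * x)" by simp
  qed (use assms kernel_integrable in auto)
  also have "\<dots> = csk_M \<nu> t - csk_M \<nu> s"
    using assms kernel_integrable by (simp add: csk_M_def)
  finally show ?thesis by simp
qed

lemma csk_M_less_1: "\<theta> < 0 \<Longrightarrow> csk_M \<nu> \<theta> < 1"
  using csk_M_strict_mono[of \<theta> 0] csk_M_zero by simp

lemma csk_M_inj: "s < 0 \<Longrightarrow> t < 0 \<Longrightarrow> csk_M \<nu> s = csk_M \<nu> t \<Longrightarrow> s = t"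
  using csk_M_strict_mono[of s t] csk_M_strict_mono[of t s] by (cases s t rule: linorder_cases) auto

lemma csk_M_continuous: "continuous_on {..0} (csk_M \<nu>)"
proof (rule continuous_on_sequentiallyI)
  fix u :: "nat \<Rightarrow> real" and a assume u: "\<forall>n. u n \<in> {..0}" and a: "a \<in> {..0}" and lim: "u \<longlonglongrightarrow> a"
  show "(\<lambda>n. csk_M \<nu> (u n)) \<longlonglongrightarrow> csk_M \<nu> a"
    unfolding csk_M_def
  proof (rule integral_dominated_convergence[where w = "\<lambda>_. 1"])
    show "AE x in \<nu>. (\<lambda>n. 1 / (1 - u n * x)) \<longlonglongrightarrow> 1 / (1 - a * x)"
      using AE_nonneg
    proof eventually_elim
      fix x :: real assume "0 \<le> x"
      then show "(\<lambda>n. 1 / (1 - u n * x)) \<longlonglongrightarrow> 1 / (1 - a * x)"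
        using one_minus_mult_ge_1[of a x] a by (intro tendsto_intros lim) auto
    qed
    show "AE x in \<nu>. norm (1 / (1 - u n * x)) \<le> 1" for n
      using AE_nonneg
    proof eventually_elim
      fix x :: real assume "0 \<le> x"
      then show "norm (1 / (1 - u n * x)) \<le> 1"
        using kernel_bounds[of "u n" x] u by simp
    qed
  qed auto
qed

lemma csk_M_at_left_0: "(csk_M \<nu> \<longlongrightarrow> 1) (at_left 0)"
proof -
  have "(csk_M \<nu> \<longlongrightarrow> csk_M \<nu> 0) (at 0 within {..0})"
    using csk_M_continuous by (simp add: continuous_on_def)
  then show ?thesis
    unfolding csk_M_zero by (rule tendsto_within_subset) auto
qed

text \<open>As \<theta> tends to minus infinity the kernel tends pointwise to the indicator of 0
  while staying bounded by 1, so only the atom at 0 survives.\<close>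

lemma csk_M_at_bot: "(csk_M \<nu> \<longlongrightarrow> measure \<nu> {0}) at_bot"
  unfolding filterlim_at_bot_mirror
proof -
  have "((\<lambda>t. \<integral>x. 1 / (1 - (- t) * x) \<partial>\<nu>) \<longlongrightarrow> (\<integral>x. indicator {0} x \<partial>\<nu>)) at_top"
  proof (rule integral_dominated_convergence_at_top[where w = "\<lambda>_. 1"])
    show "\<forall>\<^sub>F t in at_top. AE x in \<nu>. norm (1 / (1 - (- t) * x)) \<le> 1"
      using eventually_ge_at_top[of 0]
    proof eventually_elim
      fix t :: real assume "0 \<le> t"
      show "AE x in \<nu>. norm (1 / (1 - (- t) * x)) \<le> 1"
        using AE_nonneg
      proof eventually_elim
        fix x :: real assume "0 \<le> x"
        then show "norm (1 / (1 - (- t) * x)) \<le> 1"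
          using kernel_bounds[of "- t" x] \<open>0 \<le> t\<close> by simp
      qed
    qed
    show "AE x in \<nu>. ((\<lambda>t. 1 / (1 - (- t) * x)) \<longlongrightarrow> indicator {0} x) at_top"
      using AE_nonneg
    proof eventually_elim
      fix x :: real assume x: "0 \<le> x"
      show "((\<lambda>t. 1 / (1 - (- t) * x)) \<longlongrightarrow> indicator {0} x) at_top"
      proof (cases "x = 0")
        case False
        then have "filterlim (\<lambda>t. 1 + t * x) at_top at_top"
          using x by (intro filterlim_tendsto_add_at_top[OF tendsto_const]
              filterlim_at_top_mult_tendsto_pos[OF tendsto_const] filterlim_ident) auto
        then show ?thesis
          using False by (auto intro!: tendsto_divide_0[OF tendsto_const] filterlim_at_top_imp_at_infinity)
      qed auto
    qed
  qed auto
  then show "((\<lambda>t. csk_M \<nu> (- t)) \<longlongrightarrow> measure \<nu> {0}) at_top"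
    by (simp add: csk_M_def)
qed

lemma csk_M_greater:
  assumes "\<theta> < 0"
  shows "measure \<nu> {0} < csk_M \<nu> \<theta>"
proof -
  have "measure \<nu> {0} \<le> csk_M \<nu> (\<theta> - 1)"
  proof (rule tendsto_upperbound[OF csk_M_at_bot])
    show "\<forall>\<^sub>F t in at_bot. csk_M \<nu> t \<le> csk_M \<nu> (\<theta> - 1)"
      using eventually_le_at_bot[of "\<theta> - 2"]
    proof eventually_elim
      fix t assume "t \<le> \<theta> - 2"
      then show "csk_M \<nu> t \<le> csk_M \<nu> (\<theta> - 1)"
        using csk_M_strict_mono[of t "\<theta> - 1"] assms by simp
    qed
  qed simp
  also have "\<dots> < csk_M \<nu> \<theta>" using csk_M_strict_mono[of "\<theta> - 1" \<theta>] assms by simp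
  finally show ?thesis .
qed

lemma csk_M_pos: "\<theta> < 0 \<Longrightarrow> 0 < csk_M \<nu> \<theta>"
  using csk_M_greater[of \<theta>] measure_nonneg[of \<nu> "{0}"] by linarith

lemma csk_M_surj:
  assumes "measure \<nu> {0} < y" "y < 1"
  obtains \<theta> where "\<theta> < 0" "csk_M \<nu> \<theta> = y"
proof (rule IVT_negative_axis[of "csk_M \<nu>"])
  show "continuous_on {..<0} (csk_M \<nu>)"
    by (rule continuous_on_subset[OF csk_M_continuous]) auto
  show "\<exists>\<^sub>F t in at_left 0. y < csk_M \<nu> t"
    using order_tendstoD(1)[OF csk_M_at_left_0 assms(2)] by (rule eventually_frequently[rotated]) simp
qed (use assms csk_M_at_bot that in auto)

section \<open>Members of the family and the mean map\<close>

lemma integral_csk_P: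
  fixes f :: "real \<Rightarrow> real"
  assumes "\<theta> < 0" and [measurable]: "f \<in> borel_measurable borel"
  shows "(\<integral>x. f x \<partial>csk_P \<nu> \<theta>) = (\<integral>x. f x / (1 - \<theta> * x) \<partial>\<nu>) / csk_M \<nu> \<theta>"
    and "integrable (csk_P \<nu> \<theta>) f \<longleftrightarrow> integrable \<nu> (\<lambda>x. f x / (1 - \<theta> * x))"
proof -
  have nn: "AE x in \<nu>. 0 \<le> 1 / (csk_M \<nu> \<theta> * (1 - \<theta> * x))"
    using AE_nonneg
  proof eventually_elim
    fix x :: real assume "0 \<le> x"
    then show "0 \<le> 1 / (csk_M \<nu> \<theta> * (1 - \<theta> * x))"
      using one_minus_mult_ge_1[of \<theta> x] csk_M_pos[of \<theta>] assms by simp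
  qed
  have eq: "(\<lambda>x. (1 / (csk_M \<nu> \<theta> * (1 - \<theta> * x))) *\<^sub>R f x) = (\<lambda>x. f x / (1 - \<theta> * x) / csk_M \<nu> \<theta>)"
    by (simp add: field_simps)
  show "(\<integral>x. f x \<partial>csk_P \<nu> \<theta>) = (\<integral>x. f x / (1 - \<theta> * x) \<partial>\<nu>) / csk_M \<nu> \<theta>"
    unfolding csk_P_def by (subst integral_density[OF _ _ nn]) (simp_all only: eq integral_divide_zero, simp_all)
  have "integrable (csk_P \<nu> \<theta>) f \<longleftrightarrow> integrable \<nu> (\<lambda>x. (1 / csk_M \<nu> \<theta>) * (f x / (1 - \<theta> * x)))"
    unfolding csk_P_def by (subst integrable_density[OF _ _ nn]) (simp_all add: mult.commute)
  then show "integrable (csk_P \<nu> \<theta>) f \<longleftrightarrow> integrable \<nu> (\<lambda>x. f x / (1 - \<theta> * x))"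
    using csk_M_pos[OF assms(1)]
      integrable_mult_left_iff[of \<nu> "1 / csk_M \<nu> \<theta>" "\<lambda>x. f x / (1 - \<theta> * x)"]
    by (metis divide_eq_0_iff less_irrefl zero_neq_one)
qed

lemma csk_mean_eq:
  assumes "\<theta> < 0"
  shows "csk_mean \<nu> \<theta> = (csk_M \<nu> \<theta> - 1) / (\<theta> * csk_M \<nu> \<theta>)"
  using integral_csk_P(1)[OF assms, of "\<lambda>x. x"] ratio_integral[OF assms]
  by (simp add: csk_mean_def)

lemma csk_mean_pos: "\<theta> < 0 \<Longrightarrow> 0 < csk_mean \<nu> \<theta>"
  using csk_M_pos[of \<theta>] csk_M_less_1[of \<theta>] by (simp add: csk_mean_eq divide_neg_neg mult_neg_pos)

lemma csk_mean_continuous: "continuous_on {..<0} (csk_mean \<nu>)"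
proof -
  have "continuous_on {..<0} (csk_M \<nu>)"
    by (rule continuous_on_subset[OF csk_M_continuous]) auto
  then have "continuous_on {..<0} (\<lambda>\<theta>. (csk_M \<nu> \<theta> - 1) / (\<theta> * csk_M \<nu> \<theta>))"
    by (intro continuous_intros) (auto dest: csk_M_pos)
  then show ?thesis
    by (simp add: csk_mean_eq cong: continuous_on_cong_simp)
qed

text \<open>\<open>csk_mean_eq\<close> solved for the parameter. With \<open>z = M - 1\<close> and
  mean \<open>m\<close> it reads \<open>1 / \<theta> = m * (1 + z) / z\<close>, which eliminates
  \<theta> from both variance functions.\<close>

lemma csk_M_via_mean:
  assumes "\<theta> < 0"
  shows "1 / \<theta> = csk_mean \<nu> \<theta> * csk_M \<nu> \<theta> / (csk_M \<nu> \<theta> - 1)"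
  using assms csk_M_pos[OF assms] csk_M_less_1[OF assms] by (simp add: csk_mean_eq field_simps)

text \<open>Monotone convergence covers an infinite mean as well:
  \<open>x / (1 - \<theta> * x)\<close> increases to \<open>x\<close> as \<theta> increases to 0.
  Its integral is the mean times \<open>M\<close>, and \<open>M\<close> tends to 1.\<close>

lemma csk_mean_at_left_0: "((\<lambda>\<theta>. ennreal (csk_mean \<nu> \<theta>)) \<longlongrightarrow> m_zero \<nu>) (at_left 0)"
proof (rule tendsto_at_left_sequentially[of "-1"])
  fix S :: "nat \<Rightarrow> real"
  assume S: "\<And>n. S n < 0" "incseq S" "S \<longlonglongrightarrow> 0"
  define g where "g n x = ennreal (x / (1 - S n * x))" for n x
  have mono: "g n x \<le> g (Suc n) x" if "0 \<le> x" for n x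
  proof -
    have "S n * x \<le> S (Suc n) * x" using S(2) that by (simp add: incseq_SucD mult_right_mono)
    then show ?thesis
      unfolding g_def using one_minus_mult_ge_1[of "S (Suc n)" x] S(1)[of "Suc n"] that
      by (intro ennreal_leI divide_left_mono mult_pos_pos) auto
  qed
  have "m_zero \<nu> = (\<integral>\<^sup>+x. (SUP n. g n x) \<partial>\<nu>)"
    unfolding m_zero_def
  proof (rule nn_integral_cong_AE)
    show "AE x in \<nu>. ennreal x = (SUP n. g n x)"
      using AE_nonneg
    proof eventually_elim
      fix x :: real assume x: "0 \<le> x"
      have "(\<lambda>n. x / (1 - S n * x)) \<longlonglongrightarrow> x / (1 - 0 * x)"
        by (intro tendsto_intros S) auto
      then have "(\<lambda>n. g n x) \<longlonglongrightarrow> ennreal x" by (simp add: g_def)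
      moreover have "incseq (\<lambda>n. g n x)"
        by (intro incseq_SucI mono x)
      ultimately show "ennreal x = (SUP n. g n x)"
        using LIMSEQ_SUP LIMSEQ_unique by blast
    qed
  qed
  also have "\<dots> = (SUP n. integral\<^sup>N \<nu> (g n))"
    by (rule nn_integral_monotone_convergence_SUP_AE) (use mono AE_nonneg in \<open>auto simp: g_def\<close>)
  finally have sup: "m_zero \<nu> = (SUP n. integral\<^sup>N \<nu> (g n))" .
  have int: "integral\<^sup>N \<nu> (g n) = ennreal (csk_mean \<nu> (S n) * csk_M \<nu> (S n))" for n
  proof -
    have "AE x in \<nu>. 0 \<le> x / (1 - S n * x)"
      using AE_nonneg
    proof eventually_elim
      fix x :: real assume "0 \<le> x"
      then show "0 \<le> x / (1 - S n * x)" using one_minus_mult_ge_1[of "S n" x] S(1)[of n] by simp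
    qed
    then have "integral\<^sup>N \<nu> (g n) = ennreal (\<integral>x. x / (1 - S n * x) \<partial>\<nu>)"
      unfolding g_def using ratio_integrable[OF S(1)] by (intro nn_integral_eq_integral)
    also have "(\<integral>x. x / (1 - S n * x) \<partial>\<nu>) = csk_mean \<nu> (S n) * csk_M \<nu> (S n)"
      using ratio_integral[OF S(1)] csk_mean_eq[OF S(1)] csk_M_pos[OF S(1), of n] by simp
    finally show ?thesis .
  qed
  have "incseq (\<lambda>n. integral\<^sup>N \<nu> (g n))"
    by (intro incseq_SucI nn_integral_mono_AE) (use mono AE_nonneg in auto)
  then have "(\<lambda>n. ennreal (csk_mean \<nu> (S n) * csk_M \<nu> (S n))) \<longlonglongrightarrow> m_zero \<nu>"
    unfolding sup int[symmetric] by (rule LIMSEQ_SUP)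
  \<comment> \<open>The factor \<open>M\<close> is removed by its reciprocal. As that tends to 1,
    the product has a limit even if \<open>m_zero \<nu>\<close> is infinite.\<close>
  moreover have "(\<lambda>n. ennreal (1 / csk_M \<nu> (S n))) \<longlonglongrightarrow> ennreal (1 / 1)"
  proof (intro tendsto_ennrealI tendsto_intros)
    show "(\<lambda>n. csk_M \<nu> (S n)) \<longlonglongrightarrow> 1"
      by (rule filterlim_compose[OF csk_M_at_left_0])
        (use S in \<open>auto intro!: tendsto_imp_filterlim_at_left\<close>)
  qed auto
  ultimately have "(\<lambda>n. ennreal (csk_mean \<nu> (S n) * csk_M \<nu> (S n)) * ennreal (1 / csk_M \<nu> (S n)))
      \<longlonglongrightarrow> m_zero \<nu> * ennreal (1 / 1)"
    by (rule tendsto_mult_ennreal) auto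
  moreover have "ennreal (csk_mean \<nu> (S n) * csk_M \<nu> (S n)) * ennreal (1 / csk_M \<nu> (S n))
      = ennreal (csk_mean \<nu> (S n))" for n
    using csk_mean_pos[OF S(1), of n] csk_M_pos[OF S(1), of n]
    by (subst ennreal_mult[symmetric]) auto
  ultimately show "(\<lambda>n. ennreal (csk_mean \<nu> (S n))) \<longlonglongrightarrow> m_zero \<nu>" by simp
qed simp

section \<open>Variance within the family for a finite mean\<close>

text \<open>Division by \<open>1 - \<theta> * x\<close> reduces the quadratic growth to linear
  growth, so a finite first moment of \<nu> suffices.\<close>

lemma variance_integral:
  assumes "\<theta> < 0" "m_zero \<nu> < \<top>"
  shows "integrable (csk_P \<nu> \<theta>) (\<lambda>x. (x - csk_mean \<nu> \<theta>)\<^sup>2)"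
    and "(\<integral>x. (x - csk_mean \<nu> \<theta>)\<^sup>2 \<partial>csk_P \<nu> \<theta>)
         = csk_mean \<nu> \<theta> * (csk_mean \<nu> \<theta> - enn2real (m_zero \<nu>)) / (csk_M \<nu> \<theta> - 1)"
proof -
  define m where "m = csk_mean \<nu> \<theta>"
  \<comment> \<open>Polynomial division of \<open>(x - m)\<^sup>2\<close> by
    \<open>1 - \<theta> * x\<close>: a linear quotient, and as remainder the value of the square at
    \<open>x = 1 / \<theta>\<close>.\<close>
  define f where "f x = - (1 / \<theta>) * x + (2 * m - 1 / \<theta>) / \<theta> + (1 / \<theta> - m)\<^sup>2 * (1 / (1 - \<theta> * x))" for x
  have f: "(x - m)\<^sup>2 / (1 - \<theta> * x) = f x" if "0 \<le> x" for x
    using one_minus_mult_ge_1[of \<theta> x] that assms(1)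
    unfolding f_def by (simp add: divide_simps power2_eq_square) (simp add: algebra_simps)
  have [measurable]: "f \<in> borel_measurable borel"
    unfolding f_def by measurable
  have int_x: "integrable \<nu> (\<lambda>x. x)"
    using assms(2) AE_nonneg by (intro integrableI_nonneg) (auto simp: m_zero_def)
  have m0: "(\<integral>x. x \<partial>\<nu>) = enn2real (m_zero \<nu>)"
    using AE_nonneg by (simp add: m_zero_def integral_eq_nn_integral)
  have int_k: "integrable \<nu> (\<lambda>x. 1 / (1 - \<theta> * x))"
    using kernel_integrable[of \<theta>] assms(1) by simp
  have int_f: "integrable \<nu> f"
    unfolding f_def
    by (intro Bochner_Integration.integrable_add integrable_mult_right int_x int_k integrable_const)
  have eq_AE: "AE x in \<nu>. (x - m)\<^sup>2 / (1 - \<theta> * x) = f x"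
    using AE_nonneg f by auto
  have "integrable \<nu> (\<lambda>x. (x - m)\<^sup>2 / (1 - \<theta> * x))"
    using int_f by (subst integrable_cong_AE[OF _ _ eq_AE]) auto
  then show "integrable (csk_P \<nu> \<theta>) (\<lambda>x. (x - csk_mean \<nu> \<theta>)\<^sup>2)"
    unfolding m_def by (subst integral_csk_P(2)[OF assms(1)]) auto
  have "(\<integral>x. (x - m)\<^sup>2 / (1 - \<theta> * x) \<partial>\<nu>) = integral\<^sup>L \<nu> f"
    by (rule integral_cong_AE[OF _ _ eq_AE]) auto
  also have "\<dots> = - (1 / \<theta>) * enn2real (m_zero \<nu>) + (2 * m - 1 / \<theta>) / \<theta> + (1 / \<theta> - m)\<^sup>2 * csk_M \<nu> \<theta>"
    unfolding f_def using int_x int_k prob_space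
    by (simp add: m0 csk_M_def del: times_divide_eq_left times_divide_eq_right mult_minus_left)
  finally have "(\<integral>x. (x - m)\<^sup>2 \<partial>csk_P \<nu> \<theta>) =
     (- (1 / \<theta>) * enn2real (m_zero \<nu>) + (2 * m - 1 / \<theta>) / \<theta> + (1 / \<theta> - m)\<^sup>2 * csk_M \<nu> \<theta>) / csk_M \<nu> \<theta>"
    by (subst integral_csk_P(1)[OF assms(1)]) auto
  also have "\<dots> = m * (m - enn2real (m_zero \<nu>)) / (csk_M \<nu> \<theta> - 1)"
  proof -
    \<comment> \<open>Here \<open>u\<close> is \<open>1 / \<theta>\<close> in the form given by
      \<open>csk_M_via_mean\<close>. The identity \<open>u - m = u / M\<close> absorbs the factor
      \<open>M\<close>, and the numerator collapses to \<open>u * (m - m0)\<close>.\<close>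
    have "(- u * m0 + (2 * m - u) * u + (u - m)\<^sup>2 * M) / M = m * (m - m0) / (M - 1)"
      if M: "M \<noteq> 0" "M - 1 \<noteq> 0" "u = m * M / (M - 1)" for M u m0 :: real
    proof -
      have "u - m = u / M" using M by (simp add: field_simps)
      then have "- u * m0 + (2 * m - u) * u + (u - m)\<^sup>2 * M = - u * m0 + (2 * m - u) * u + (u - m) * u"
        using M(1) by (simp add: power2_eq_square)
      also have "\<dots> = u * (m - m0)" by (simp add: algebra_simps)
      finally show ?thesis using M by simp
    qed
    from this[OF _ _ csk_M_via_mean[OF assms(1), folded m_def], of "enn2real (m_zero \<nu>)"] show ?thesis
      using csk_M_pos[OF assms(1)] csk_M_less_1[OF assms(1)] by simp
  qed
  finally show "(\<integral>x. (x - csk_mean \<nu> \<theta>)\<^sup>2 \<partial>csk_P \<nu> \<theta>)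
         = csk_mean \<nu> \<theta> * (csk_mean \<nu> \<theta> - enn2real (m_zero \<nu>)) / (csk_M \<nu> \<theta> - 1)"
    by (simp add: m_def)
qed

section \<open>The transforms \<open>\<Psi>\<close>, \<open>\<chi>\<close> and \<open>S\<close> at
  real points\<close>

lemma Psi_transform_of_real:
  assumes "\<theta> < 0"
  shows "Psi_transform \<nu> (of_real \<theta>) = of_real (csk_M \<nu> \<theta> - 1)"
proof -
  have "Psi_transform \<nu> (of_real \<theta>) = (\<integral>x. complex_of_real (\<theta> * (x / (1 - \<theta> * x))) \<partial>\<nu>)"
    unfolding Psi_transform_def by simp
  also have "\<dots> = of_real (\<theta> * (\<integral>x. x / (1 - \<theta> * x) \<partial>\<nu>))"
    by (simp only: integral_complex_of_real integral_mult_right_zero)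
  also have "\<dots> = of_real (csk_M \<nu> \<theta> - 1)"
    using assms by (simp add: ratio_integral)
  finally show ?thesis .
qed

text \<open>Together with strict monotonicity of \<open>\<Psi>\<close> on the negative axis, this replaces its univalence on
  the half-plane.\<close>

lemma Psi_transform_real_imp_real:
  assumes "Re w < 0" "Im (Psi_transform \<nu> w) = 0"
  shows "Im w = 0"
proof (rule ccontr)
  assume w: "Im w \<noteq> 0"
  define F where "F x = w * complex_of_real x / (1 - w * complex_of_real x)" for x
  \<comment> \<open>The imaginary part of the integrand is \<open>Im w\<close> times
    \<open>g\<close>, and \<open>g\<close> is positive for positive \<open>x\<close>. So the
    imaginary part of the transform is \<open>Im w\<close> times a positive number.\<close>
  define g where "g x = x / (cmod (1 - w * complex_of_real x))\<^sup>2" for x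
  have F_Im: "Im (F x) = Im w * g x" for x
    by (simp add: F_def g_def Im_divide cmod_power2 algebra_simps)
  have [measurable]: "F \<in> borel_measurable borel"
    unfolding F_def by measurable
  have denom: "1 - Re w * x \<le> cmod (1 - w * complex_of_real x)" for x
    using complex_Re_le_cmod[of "1 - w * complex_of_real x"] by simp
  have F_int: "integrable \<nu> F"
  proof (rule integrable_bounded[where B = "cmod w / - Re w"])
    fix x :: real assume x: "0 \<le> x"
    have "- Re w * x \<le> cmod (1 - w * complex_of_real x)" using denom[of x] by simp
    moreover have "0 < cmod (1 - w * complex_of_real x)"
      using denom[of x] one_minus_mult_ge_1[of "Re w" x] assms(1) x by linarith
    ultimately show "cmod (F x) \<le> cmod w / - Re w"
      using mult_left_mono[of "- Re w * x" "cmod (1 - w * complex_of_real x)" "cmod w"] x assms(1)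
      by (simp add: F_def norm_divide norm_mult field_simps)
  qed simp
  then have "integrable \<nu> (\<lambda>x. Im w * g x)"
    using integrable_Im[OF F_int] by (simp add: F_Im)
  then have "integrable \<nu> g" using w by simp
  then have "0 < integral\<^sup>L \<nu> g"
  proof (rule integral_pos)
    fix x :: real assume "0 < x"
    then have "0 < cmod (1 - w * complex_of_real x)"
      using denom[of x] one_minus_mult_ge_1[of "Re w" x] assms(1) by linarith
    then show "0 < g x" using \<open>0 < x\<close> by (simp add: g_def)
  qed (simp add: g_def)
  moreover have "Im (Psi_transform \<nu> w) = Im w * integral\<^sup>L \<nu> g"
    using integral_Im[OF F_int] by (simp add: Psi_transform_def F_def[symmetric] F_Im)
  ultimately show False using assms(2) w by simp
qed

text \<open>Reduces the complex transforms to \<open>csk_M\<close>: it makes the preimage of a real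
  value unique, and it turns membership in \<open>S_domain\<close> into a negative
  parameter.\<close>

lemma Psi_transform_eq_of_realD:
  assumes "w \<in> left_half_plane" "Psi_transform \<nu> w = of_real z"
  obtains \<theta> where "\<theta> < 0" "w = of_real \<theta>" "csk_M \<nu> \<theta> - 1 = z"
proof -
  have "Im w = 0"
    using Psi_transform_real_imp_real[of w] assms by (simp add: left_half_plane_def)
  then have w: "w = of_real (Re w)" by (simp add: complex_eq_iff)
  have neg: "Re w < 0" using assms by (simp add: left_half_plane_def)
  have "complex_of_real (csk_M \<nu> (Re w) - 1) = of_real z"
    using Psi_transform_of_real[OF neg] assms(2) w by metis
  then have "csk_M \<nu> (Re w) - 1 = z" by (simp only: of_real_eq_iff)
  then show ?thesis using that[OF neg w] by simp
qed

text \<open>\<open>the_inv_into\<close> is a definite description, so the real value must have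
  exactly one preimage. Any preimage lies on the negative axis, where \<open>csk_M\<close> is
  injective.\<close>

lemma chi_transform_of_real:
  assumes "\<theta> < 0"
  shows "chi_transform \<nu> (of_real (csk_M \<nu> \<theta> - 1)) = of_real \<theta>"
  unfolding chi_transform_def the_inv_into_def
proof (rule the_equality)
  show "of_real \<theta> \<in> left_half_plane \<and> Psi_transform \<nu> (of_real \<theta>) = of_real (csk_M \<nu> \<theta> - 1)"
    using assms Psi_transform_of_real[OF assms] by (simp add: left_half_plane_def)
next
  fix w assume "w \<in> left_half_plane \<and> Psi_transform \<nu> w = of_real (csk_M \<nu> \<theta> - 1)"
  then obtain t where "t < 0" "w = of_real t" "csk_M \<nu> t - 1 = csk_M \<nu> \<theta> - 1"
    using Psi_transform_eq_of_realD by blast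
  then show "w = of_real \<theta>" using csk_M_inj[of t \<theta>] assms by simp
qed

lemma S_transform_of_real:
  assumes "\<theta> < 0"
  shows "S_transform \<nu> (of_real (csk_M \<nu> \<theta> - 1)) = of_real (1 / csk_mean \<nu> \<theta>)"
  unfolding S_transform_def chi_transform_of_real[OF assms] csk_mean_eq[OF assms] by simp

end

section \<open>Non-degenerate laws: injectivity and range of the mean map, variance
  functions\<close>

lemma eq_return_if_AE_eq:
  assumes "prob_space M" "sets M = sets borel" "AE x in M. x = (c::real)"
  shows "M = return borel c"
proof (rule measure_eqI)
  fix A assume A: "A \<in> sets M"
  interpret prob_space M by fact
  show "emeasure M A = emeasure (return borel c) A"
  proof (cases "c \<in> A")
    case True
    then have "AE x in M. x \<in> A" using assms(3) by auto
    then show ?thesis using emeasure_eq_1_AE[OF A] A assms(2) True by simp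
  next
    case False
    then have "AE x in M. x \<notin> A" using assms(3) by auto
    then have "emeasure M A = 0" using AE_iff_measurable[OF A, of "\<lambda>x. x \<notin> A"] sets.sets_into_space[OF A] by blast
    then show ?thesis using A assms(2) False by simp
  qed
qed (simp add: assms)

locale nondeg_law = nonneg_law +
  assumes nondeg: "\<And>c. \<nu> \<noteq> return borel c"
begin

text \<open>With \<open>c\<close> the mean at \<open>s\<close>, the function \<open>(x - c) / (1 - s x)\<close> has integral 0; a suitable multiple of it
  subtracted from \<open>(x - c) / (1 - t x)\<close> leaves a nonnegative multiple of \<open>(x - c)\<^sup>2\<close>.\<close>

lemma csk_mean_strict_mono:
  assumes "s < t" "t < 0"
  shows "csk_mean \<nu> s < csk_mean \<nu> t"
proof -
  define c where "c = csk_mean \<nu> s"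
  \<comment> \<open>Chosen so that \<open>1 / (1 - t * x) - l / (1 - s * x)\<close> vanishes at
    \<open>x = c\<close>; this supplies the second factor \<open>x - c\<close>.\<close>
  define l where "l = (1 - s * c) / (1 - t * c)"
  define h where "h r x = x / (1 - r * x) - c * (1 / (1 - r * x))" for r x :: real
  have c: "0 < c" using csk_mean_pos assms by (simp add: c_def)
  have h_int: "integrable \<nu> (h r)" if "r < 0" for r
    unfolding h_def using that
    by (intro Bochner_Integration.integrable_diff integrable_mult_right ratio_integrable kernel_integrable) auto
  have h_eq: "integral\<^sup>L \<nu> (h r) = csk_M \<nu> r * (csk_mean \<nu> r - c)" if "r < 0" for r
  proof -
    have "integral\<^sup>L \<nu> (h r) = (csk_M \<nu> r - 1) / r - c * csk_M \<nu> r"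
      unfolding h_def using ratio_integrable[OF that] kernel_integrable[of r] that
      by (simp add: ratio_integral csk_M_def del: times_divide_eq_right)
    also have "\<dots> = csk_M \<nu> r * (csk_mean \<nu> r - c)"
      using csk_M_pos[OF that] that by (simp add: csk_mean_eq field_simps)
    finally show ?thesis .
  qed
  have key: "h t x - l * h s x = (x - c)\<^sup>2 * (t - s) / ((1 - s * x) * (1 - t * x) * (1 - t * c))"
    if x: "0 \<le> x" for x
  proof -
    have "1 - s * x \<noteq> 0" "1 - t * x \<noteq> 0" "1 - t * c \<noteq> 0"
      using one_minus_mult_ge_1[of s x] one_minus_mult_ge_1[of t x] one_minus_mult_ge_1[of t c] x c assms
      by auto
    moreover have h: "h r x = (x - c) / (1 - r * x)" for r
      by (simp add: h_def diff_divide_distrib)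
    ultimately show ?thesis
      unfolding h by (simp add: l_def power2_eq_square divide_simps) (simp add: algebra_simps)
  qed
  have pos: "0 < (1 - s * x) * (1 - t * x) * (1 - t * c)" if "0 \<le> x" for x
    using one_minus_mult_ge_1[of s x] one_minus_mult_ge_1[of t x] one_minus_mult_ge_1[of t c] that c assms
    by (intro mult_pos_pos) auto
  have "0 < (\<integral>x. h t x - l * h s x \<partial>\<nu>)"
  proof (rule integral_pos_if_not_AE_zero)
    show "integrable \<nu> (\<lambda>x. h t x - l * h s x)"
      using h_int[of t] h_int[of s] assms by simp
    show "AE x in \<nu>. 0 \<le> h t x - l * h s x"
      using AE_nonneg by eventually_elim (use pos assms in \<open>simp add: key less_imp_le\<close>)
    show "\<not> (AE x in \<nu>. h t x - l * h s x = 0)"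
    proof
      assume "AE x in \<nu>. h t x - l * h s x = 0"
      with AE_nonneg have "AE x in \<nu>. x = c"
      proof eventually_elim
        fix x :: real assume "0 \<le> x" "h t x - l * h s x = 0"
        then show "x = c" using pos[of x] assms by (auto simp: key)
      qed
      then have "\<nu> = return borel c"
        by (intro eq_return_if_AE_eq) (auto intro: prob_space_axioms)
      then show False using nondeg by simp
    qed
  qed
  also have "\<dots> = csk_M \<nu> t * (csk_mean \<nu> t - c)"
    using h_int[of t] h_int[of s] h_eq[of t] h_eq[of s] assms by (simp add: c_def)
  finally show ?thesis
    using csk_M_pos[of t] assms by (simp add: zero_less_mult_iff c_def)
qed

lemma csk_mean_inj: "inj_on (csk_mean \<nu>) {..<0}"
  by (rule linorder_inj_onI') (use csk_mean_strict_mono in force)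

lemma csk_psi_csk_mean: "\<theta> < 0 \<Longrightarrow> csk_psi \<nu> (csk_mean \<nu> \<theta>) = \<theta>"
  unfolding csk_psi_def by (rule the_inv_into_f_f[OF csk_mean_inj]) simp

text \<open>\<open>m_minus\<close> is a \<open>Lim\<close>, meaningful only once convergence is
  known. The mean map is increasing and positive, so it converges to its infimum.\<close>

lemma csk_mean_at_bot: "(csk_mean \<nu> \<longlongrightarrow> m_minus \<nu>) at_bot"
proof -
  define L where "L = Inf (csk_mean \<nu> ` {..<0})"
  have bdd: "bdd_below (csk_mean \<nu> ` {..<0})"
    by (rule bdd_belowI2[of _ 0]) (simp add: csk_mean_pos less_imp_le)
  have "(csk_mean \<nu> \<longlongrightarrow> L) at_bot"
  proof (rule decreasing_tendsto)
    show "\<forall>\<^sub>F t in at_bot. L \<le> csk_mean \<nu> t"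
      using eventually_gt_at_bot[of 0]
      by eventually_elim (auto simp: L_def intro!: cInf_lower bdd)
    fix y assume "L < y"
    then obtain s where s: "s < 0" "csk_mean \<nu> s < y"
      unfolding L_def using cInf_lessD[of "csk_mean \<nu> ` {..<0}" y] lessThan_iff[of "-1" "0::real"] by auto
    show "\<forall>\<^sub>F t in at_bot. csk_mean \<nu> t < y"
      using eventually_gt_at_bot[of s]
      by eventually_elim (use csk_mean_strict_mono s in force)
  qed
  then show ?thesis
    unfolding m_minus_def using tendsto_Lim[OF trivial_limit_at_bot_linorder] by blast
qed

text \<open>The ends of the domain are the limits of the continuous mean map at minus infinity and
  at 0, so every value in between is attained.\<close>

lemma domain_of_meansD:
  assumes "m \<in> domain_of_means \<nu>"
  obtains \<theta> where "\<theta> < 0" "csk_mean \<nu> \<theta> = m"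
proof (rule IVT_negative_axis[OF csk_mean_continuous csk_mean_at_bot])
  show "m_minus \<nu> < m" using assms by (simp add: domain_of_means_def)
  have "\<forall>\<^sub>F t in at_left 0. ennreal m < ennreal (csk_mean \<nu> t)"
    using assms by (intro order_tendstoD(1)[OF csk_mean_at_left_0]) (simp add: domain_of_means_def)
  then have "\<forall>\<^sub>F t in at_left 0. m < csk_mean \<nu> t"
    by eventually_elim (metis ennreal_leI not_le)
  then show "\<exists>\<^sub>F t in at_left 0. m < csk_mean \<nu> t"
    by (rule eventually_frequently[rotated]) simp
qed (use that in auto)

text \<open>With \<open>z = M - 1\<close>, \<open>csk_M_via_mean\<close> gives
  \<open>1 / \<theta> - m = m / z\<close>.\<close>

lemma pseudo_variance_csk_mean:
  assumes "\<theta> < 0"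
  shows "pseudo_variance \<nu> (csk_mean \<nu> \<theta>) = (csk_mean \<nu> \<theta>)\<^sup>2 / (csk_M \<nu> \<theta> - 1)"
  unfolding pseudo_variance_def csk_psi_csk_mean[OF assms] csk_M_via_mean[OF assms]
  using csk_M_less_1[OF assms] by (simp add: field_simps power2_eq_square)

lemma csk_variance_csk_mean:
  assumes "\<theta> < 0" "m_zero \<nu> < \<top>"
  shows "csk_variance \<nu> (csk_mean \<nu> \<theta>)
    = csk_mean \<nu> \<theta> * (csk_mean \<nu> \<theta> - enn2real (m_zero \<nu>)) / (csk_M \<nu> \<theta> - 1)"
  using variance_integral(2)[OF assms]
  by (simp add: csk_variance_def csk_Q_def csk_psi_csk_mean[OF assms(1)])

lemma csk_variance_exists_if_finite_mean:
  assumes "m_zero \<nu> < \<top>"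
  shows "csk_variance_exists \<nu>"
  unfolding csk_variance_exists_def
proof
  fix m assume "m \<in> domain_of_means \<nu>"
  then obtain \<theta> where "\<theta> < 0" "csk_mean \<nu> \<theta> = m" by (rule domain_of_meansD)
  then show "integrable (csk_Q \<nu> m) (\<lambda>x. (x - m)\<^sup>2)"
    using variance_integral(1)[OF _ assms, of \<theta>] csk_psi_csk_mean[of \<theta>] by (auto simp: csk_Q_def)
qed

end

lemma nondeg_lawI:
  assumes "nondeg_prob_nonneg \<nu>"
  shows "nondeg_law \<nu>"
proof -
  have prob: "prob_space \<nu>" and sets: "sets \<nu> = sets borel" and nonneg: "AE x in \<nu>. 0 \<le> x"
    and nd: "\<nu> \<noteq> return borel c" for c
    using assms by (auto simp: nondeg_prob_nonneg_def)
  interpret prob_space \<nu> by fact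
  have "measure \<nu> {0} \<noteq> 1"
  proof
    assume "measure \<nu> {0} = 1"
    then have "AE x in \<nu>. x = 0"
      using prob_eq_1[of "{0}"] sets by simp
    then show False using eq_return_if_AE_eq[OF prob sets] nd by blast
  qed
  then have "measure \<nu> {0} < 1" using prob_le_1[of "{0}"] by linarith
  with prob sets nonneg nd show ?thesis
    by (auto simp: nondeg_law_def nonneg_law_def nonneg_law_axioms_def nondeg_law_axioms_def)
qed

section \<open>Continuity of powers on the extended half-line\<close>

lemma tendsto_ennreal_powr:
  assumes "(f \<longlongrightarrow> l) F" "\<alpha> > 0"
  shows "((\<lambda>t. ennreal_powr (f t) \<alpha>) \<longlongrightarrow> ennreal_powr l \<alpha>) F"
proof (cases "l = \<top>")
  case True
  have "((\<lambda>t. ennreal_powr (f t) \<alpha>) \<longlongrightarrow> \<top>) F"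
    unfolding tendsto_top_iff_ennreal
  proof (intro allI impI)
    fix r :: real assume r: "0 \<le> r"
    \<comment> \<open>The power exceeds \<open>r\<close> as soon as the base exceeds
      \<open>r powr (1 / \<alpha>)\<close>.\<close>
    have "\<forall>\<^sub>F t in F. ennreal (r powr (1 / \<alpha>)) < f t"
      using assms(1) True by (simp add: tendsto_top_iff_ennreal)
    then show "\<forall>\<^sub>F t in F. ennreal r < ennreal_powr (f t) \<alpha>"
    proof eventually_elim
      fix t assume less: "ennreal (r powr (1 / \<alpha>)) < f t"
      show "ennreal r < ennreal_powr (f t) \<alpha>"
      proof (cases "f t")
        case (real x)
        then have "r powr (1 / \<alpha>) < x" using less by (simp add: ennreal_less_iff)
        then have "(r powr (1 / \<alpha>)) powr \<alpha> < x powr \<alpha>"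
          using assms(2) by (intro powr_less_mono2) auto
        then show ?thesis using real r assms(2) by (simp add: ennreal_powr_def powr_powr ennreal_less_iff)
      qed (simp add: ennreal_powr_def)
    qed
  qed
  then show ?thesis using True by (simp add: ennreal_powr_def)
next
  case False
  then obtain x where x: "l = ennreal x" "0 \<le> x" by (cases l) auto
  have "((\<lambda>t. enn2real (f t)) \<longlongrightarrow> x) F"
    using assms(1) x by (intro tendsto_enn2real) auto
  then have "((\<lambda>t. ennreal (enn2real (f t) powr \<alpha>)) \<longlongrightarrow> ennreal (x powr \<alpha>)) F"
    using assms(2) by (intro tendsto_ennrealI tendsto_powr' tendsto_const) auto
  moreover have "\<forall>\<^sub>F t in F. ennreal (enn2real (f t) powr \<alpha>) = ennreal_powr (f t) \<alpha>"
  proof -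
    have "\<forall>\<^sub>F t in F. f t < \<top>"
      using assms(1) False by (intro order_tendstoD(2)) (auto simp: less_top)
    then show ?thesis by eventually_elim (simp add: ennreal_powr_def)
  qed
  ultimately have "((\<lambda>t. ennreal_powr (f t) \<alpha>) \<longlongrightarrow> ennreal (x powr \<alpha>)) F"
    by (rule Lim_transform_eventually)
  then show ?thesis using x by (simp add: ennreal_powr_def)
qed

section \<open>Matching the parameters of a law and of its power\<close>

locale free_mult_power = base: nondeg_law \<nu> for \<nu> :: "real measure" +
  fixes \<mu> :: "real measure" and \<alpha> :: real
  assumes exponent_pos: "\<alpha> > 0" and power: "is_free_mult_power \<nu> \<alpha> \<mu>"

sublocale free_mult_power \<subseteq> pow: nonneg_law \<mu>
  using power by (auto simp: is_free_mult_power_def nonneg_law_def nonneg_law_axioms_def)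

context free_mult_power
begin

text \<open>The value \<open>z = M - 1\<close> lies in the interval on which the S-transforms are
  related. Membership in \<open>S_domain \<mu>\<close> yields \<open>t\<close> with the same
  \<open>z\<close>, and the S-transforms there are the reciprocal means.\<close>

lemma matching_parameter:
  assumes "\<theta> < 0"
  obtains t where "t < 0" "csk_M \<mu> t = csk_M \<nu> \<theta>" "csk_mean \<mu> t = csk_mean \<nu> \<theta> powr \<alpha>"
proof -
  define z where "z = csk_M \<nu> \<theta> - 1"
  have "z \<in> {measure \<nu> {0} - 1<..<0}"
    using base.csk_M_greater[OF assms] base.csk_M_less_1[OF assms] by (simp add: z_def)
  then have dom: "complex_of_real z \<in> S_domain \<mu>"
    and S: "S_transform \<mu> (of_real z) = S_transform \<nu> (of_real z) powr of_real \<alpha>"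
    using power unfolding is_free_mult_power_def by blast+
  from dom obtain w where "w \<in> left_half_plane" "Psi_transform \<mu> w = of_real z"
    unfolding S_domain_def by auto
  then obtain t where t: "t < 0" "csk_M \<mu> t - 1 = z"
    using pow.Psi_transform_eq_of_realD by blast
  have "complex_of_real (1 / csk_mean \<mu> t) = of_real (1 / csk_mean \<nu> \<theta>) powr of_real \<alpha>"
    using S pow.S_transform_of_real[OF t(1)] base.S_transform_of_real[OF assms] t(2) z_def by metis
  also have "\<dots> = of_real ((1 / csk_mean \<nu> \<theta>) powr \<alpha>)"
    using base.csk_mean_pos[OF assms] by (intro powr_of_real) simp
  finally have "1 / csk_mean \<mu> t = (1 / csk_mean \<nu> \<theta>) powr \<alpha>"
    by (simp only: of_real_eq_iff)
  also have "\<dots> = 1 / csk_mean \<nu> \<theta> powr \<alpha>"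
    using base.csk_mean_pos[OF assms] by (simp add: powr_divide)
  finally have "csk_mean \<mu> t = csk_mean \<nu> \<theta> powr \<alpha>" by simp
  then show ?thesis using that t by (simp add: z_def)
qed

text \<open>A Dirac mass has a constant mean map, whereas two parameters of \<nu> produce two
  different means of \<mu>.\<close>

lemma power_nondeg: "\<mu> \<noteq> return borel c"
proof
  assume \<mu>: "\<mu> = return borel c"
  have c: "0 \<le> c" using pow.AE_nonneg unfolding \<mu> by (subst (asm) AE_return) auto
  have mean: "csk_mean \<mu> t = c" if "t < 0" for t
  proof -
    have "1 \<le> 1 - t * c" using one_minus_mult_ge_1[of t c] that c by simp
    moreover have M: "csk_M \<mu> t = 1 / (1 - t * c)"
      by (simp add: csk_M_def \<mu> integral_return)
    ultimately show ?thesis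
      unfolding pow.csk_mean_eq[OF that] M using that by (simp add: field_simps)
  qed
  \<comment> \<open>Any two distinct negative parameters would do in place of -2 and -1.\<close>
  obtain s t where "s < 0" "csk_mean \<mu> s = csk_mean \<nu> (-2) powr \<alpha>"
    and "t < 0" "csk_mean \<mu> t = csk_mean \<nu> (-1) powr \<alpha>"
    using matching_parameter[of "-2"] matching_parameter[of "-1"] by (metis neg_less_0_iff_less zero_less_numeral zero_less_one)
  moreover have "csk_mean \<nu> (-2) powr \<alpha> < csk_mean \<nu> (-1) powr \<alpha>"
    using exponent_pos base.csk_mean_pos[of "-2"] base.csk_mean_strict_mono[of "-2" "-1"]
    by (intro powr_less_mono2) auto
  ultimately show False using mean by simp
qed

end

sublocale free_mult_power \<subseteq> pow: nondeg_law \<mu>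
  by unfold_locales (rule power_nondeg)

context free_mult_power
begin

text \<open>An atom of \<open>\<nu>\<close> at 0 forces the means of \<open>\<nu>\<close>, and with them those of \<open>\<mu>\<close>, to tend to 0 as
  \<open>csk_M \<nu>\<close> approaches the mass of the atom. With a smaller atom of \<open>\<mu>\<close> the matching parameters
  would stay bounded, and the means of \<open>\<mu>\<close> away from 0.\<close>

lemma atom_le: "measure \<nu> {0} \<le> measure \<mu> {0}"
proof (rule ccontr)
  assume "\<not> measure \<nu> {0} \<le> measure \<mu> {0}"
  then have less: "measure \<mu> {0} < measure \<nu> {0}" by simp
  then have atom: "0 < measure \<nu> {0}" using measure_nonneg[of \<mu> "{0}"] by linarith
  \<comment> \<open>Every matching \<open>t\<close> has \<open>csk_M \<mu> t\<close> above the atom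
    of \<nu>, hence lies to the right of \<open>t0\<close>.\<close>
  obtain t0 where t0: "t0 < 0" "csk_M \<mu> t0 = measure \<nu> {0}"
    using pow.csk_M_surj[OF less base.mass_zero_less_1] .
  have bound: "csk_mean \<mu> t0 \<le> csk_mean \<nu> \<theta> powr \<alpha>" if \<theta>: "\<theta> < 0" for \<theta>
  proof -
    obtain t where t: "t < 0" "csk_M \<mu> t = csk_M \<nu> \<theta>" "csk_mean \<mu> t = csk_mean \<nu> \<theta> powr \<alpha>"
      using matching_parameter[OF \<theta>] by blast
    have "csk_M \<mu> t0 < csk_M \<mu> t" using t t0 base.csk_M_greater[OF \<theta>] by simp
    then have "t0 < t" using pow.csk_M_strict_mono[of t t0] t0(1) by (cases t t0 rule: linorder_cases) auto
    then show ?thesis using pow.csk_mean_strict_mono[of t0 t] t by simp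
  qed
  have ev: "\<forall>\<^sub>F \<theta> in at_bot. csk_mean \<mu> t0 \<le> csk_mean \<nu> \<theta> powr \<alpha>"
    using eventually_gt_at_bot[of 0] by eventually_elim (rule bound)
  \<comment> \<open>As the atom is positive, the first factor stays finite in the limit, and
    \<open>1 / \<theta>\<close> sends the product to 0.\<close>
  have "((\<lambda>\<theta>. (csk_M \<nu> \<theta> - 1) / csk_M \<nu> \<theta> * (1 / \<theta>)) \<longlongrightarrow> (measure \<nu> {0} - 1) / measure \<nu> {0} * 0) at_bot"
    using atom by (intro tendsto_intros base.csk_M_at_bot
        tendsto_divide_0[OF tendsto_const filterlim_at_bot_imp_at_infinity[OF filterlim_ident]]) auto
  then have "((\<lambda>\<theta>. (csk_M \<nu> \<theta> - 1) / csk_M \<nu> \<theta> * (1 / \<theta>)) \<longlongrightarrow> 0) at_bot" by simp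
  then have "(csk_mean \<nu> \<longlongrightarrow> 0) at_bot"
  proof (rule Lim_transform_eventually)
    show "\<forall>\<^sub>F \<theta> in at_bot. (csk_M \<nu> \<theta> - 1) / csk_M \<nu> \<theta> * (1 / \<theta>) = csk_mean \<nu> \<theta>"
      using eventually_gt_at_bot[of 0] by eventually_elim (simp add: base.csk_mean_eq)
  qed
  moreover have "\<forall>\<^sub>F \<theta> in at_bot. 0 \<le> csk_mean \<nu> \<theta>"
    using eventually_gt_at_bot[of 0] by eventually_elim (simp add: base.csk_mean_pos less_imp_le)
  ultimately have "((\<lambda>\<theta>. csk_mean \<nu> \<theta> powr \<alpha>) \<longlongrightarrow> 0 powr \<alpha>) at_bot"
    using exponent_pos by (intro tendsto_powr' tendsto_const) auto
  then have "csk_mean \<mu> t0 \<le> 0 powr \<alpha>"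
    using ev by (rule tendsto_lowerbound) simp
  then show False using pow.csk_mean_pos[OF t0(1)] by simp
qed

text \<open>By \<open>atom_le\<close>, the value \<open>csk_M \<mu> t\<close> lies in the range of
  \<open>csk_M \<nu>\<close>. Matching the \<theta> found there leads back to \<open>t\<close>,
  since \<open>csk_M \<mu>\<close> is injective.\<close>

lemma matching_parameter_inv:
  assumes "t < 0"
  obtains \<theta> where "\<theta> < 0" "csk_M \<nu> \<theta> = csk_M \<mu> t" "csk_mean \<mu> t = csk_mean \<nu> \<theta> powr \<alpha>"
proof -
  have "measure \<nu> {0} < csk_M \<mu> t" "csk_M \<mu> t < 1"
    using atom_le pow.csk_M_greater[OF assms] pow.csk_M_less_1[OF assms] by auto
  then obtain \<theta> where \<theta>: "\<theta> < 0" "csk_M \<nu> \<theta> = csk_M \<mu> t" by (rule base.csk_M_surj)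
  obtain s where s: "s < 0" "csk_M \<mu> s = csk_M \<nu> \<theta>" "csk_mean \<mu> s = csk_mean \<nu> \<theta> powr \<alpha>"
    using matching_parameter[OF \<theta>(1)] by blast
  then have "s = t" using pow.csk_M_inj[of s t] assms \<theta> by simp
  then show ?thesis using that \<theta> s by simp
qed

section \<open>End points of the domain of means\<close>

text \<open>The change of parameter \<open>h\<close> from \<mu> to \<nu> sends minus infinity to
  minus infinity and 0 to 0, so the limits of the mean map of \<mu> are the powers of those of
  \<nu>.\<close>

lemma
  shows m_minus_power: "m_minus \<mu> = m_minus \<nu> powr \<alpha>"
    and m_zero_power: "m_zero \<mu> = ennreal_powr (m_zero \<nu>) \<alpha>"
proof -
  have "\<forall>t. \<exists>\<theta>. t < 0 \<longrightarrow> \<theta> < 0 \<and> csk_M \<nu> \<theta> = csk_M \<mu> t \<and> csk_mean \<mu> t = csk_mean \<nu> \<theta> powr \<alpha>"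
    using matching_parameter_inv by metis
  then obtain h where h: "\<And>t. t < 0 \<Longrightarrow> h t < 0" "\<And>t. t < 0 \<Longrightarrow> csk_M \<nu> (h t) = csk_M \<mu> t"
      "\<And>t. t < 0 \<Longrightarrow> csk_mean \<mu> t = csk_mean \<nu> (h t) powr \<alpha>"
    by metis
  have M_less_iff: "csk_M \<nu> a < csk_M \<nu> b \<longleftrightarrow> a < b" if "a < 0" "b < 0" for a b
    using base.csk_M_strict_mono[of a b] base.csk_M_strict_mono[of b a] that
    by (cases a b rule: linorder_cases) auto
  have h_at_bot: "filterlim h at_bot at_bot"
    unfolding filterlim_at_bot_dense
  proof
    fix Z :: real
    \<comment> \<open>The minimum with -1 makes the bound a legitimate negative parameter.\<close>
    define Z' where "Z' = min Z (-1)"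
    have Z': "Z' < 0" "Z' \<le> Z" by (auto simp: Z'_def)
    \<comment> \<open>That \<open>csk_M \<nu> Z'\<close> is also a value of
      \<open>csk_M \<mu>\<close> puts it strictly above the limit of \<open>csk_M \<mu>\<close> at
      minus infinity.\<close>
    obtain s where "s < 0" "csk_M \<mu> s = csk_M \<nu> Z'" using matching_parameter[OF Z'(1)] by blast
    then have "measure \<mu> {0} < csk_M \<nu> Z'" using pow.csk_M_greater[of s] by simp
    from order_tendstoD(2)[OF pow.csk_M_at_bot this] eventually_gt_at_bot[of 0]
    show "\<forall>\<^sub>F t in at_bot. h t < Z"
    proof eventually_elim
      fix t :: real assume "csk_M \<mu> t < csk_M \<nu> Z'" "t < 0"
      then have "h t < Z'" using h[of t] M_less_iff[of "h t" Z'] Z' by simp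
      then show "h t < Z" using Z' by simp
    qed
  qed
  have h_at_0: "filterlim h (at_left 0) (at_left 0)"
  proof (rule tendsto_imp_filterlim_at_left)
    have neg: "\<forall>\<^sub>F t in at_left 0. t < (0::real)"
      by (simp add: eventually_at_filter)
    show "\<forall>\<^sub>F t in at_left 0. h t < 0" using neg by eventually_elim (rule h)
    show "(h \<longlongrightarrow> 0) (at_left 0)"
    proof (rule order_tendstoI)
      fix a :: real assume "a < 0"
      from order_tendstoD(1)[OF pow.csk_M_at_left_0 base.csk_M_less_1[OF this]] neg
      show "\<forall>\<^sub>F t in at_left 0. a < h t"
        by eventually_elim (use h M_less_iff \<open>a < 0\<close> in metis)
    next
      fix a :: real assume "0 < a"
      show "\<forall>\<^sub>F t in at_left 0. h t < a"
        using neg by eventually_elim (use h \<open>0 < a\<close> in force)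
    qed
  qed
  have neg_bot: "\<forall>\<^sub>F t in at_bot. t < (0::real)" by (rule eventually_gt_at_bot)
  \<comment> \<open>\<open>m_minus \<nu>\<close> may be 0; there continuity of the power rests on
    the nonnegative base and the positive exponent.\<close>
  have "((\<lambda>t. csk_mean \<nu> (h t) powr \<alpha>) \<longlongrightarrow> m_minus \<nu> powr \<alpha>) at_bot"
  proof (intro tendsto_powr' tendsto_const filterlim_compose[OF base.csk_mean_at_bot h_at_bot] disjI2 conjI exponent_pos)
    show "\<forall>\<^sub>F t in at_bot. 0 \<le> csk_mean \<nu> (h t)"
      using neg_bot by eventually_elim (simp add: h base.csk_mean_pos less_imp_le)
  qed
  then have "(csk_mean \<mu> \<longlongrightarrow> m_minus \<nu> powr \<alpha>) at_bot"
    by (rule Lim_transform_eventually) (use neg_bot in eventually_elim, simp add: h)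
  then show "m_minus \<mu> = m_minus \<nu> powr \<alpha>"
    using tendsto_unique[OF trivial_limit_at_bot_linorder pow.csk_mean_at_bot] by blast
  have "((\<lambda>t. ennreal_powr (ennreal (csk_mean \<nu> (h t))) \<alpha>) \<longlongrightarrow> ennreal_powr (m_zero \<nu>) \<alpha>) (at_left 0)"
    by (intro tendsto_ennreal_powr filterlim_compose[OF base.csk_mean_at_left_0 h_at_0] exponent_pos)
  then have "((\<lambda>t. ennreal (csk_mean \<mu> t)) \<longlongrightarrow> ennreal_powr (m_zero \<nu>) \<alpha>) (at_left 0)"
  proof (rule Lim_transform_eventually)
    have "\<forall>\<^sub>F t in at_left 0. t < (0::real)" by (simp add: eventually_at_filter)
    then show "\<forall>\<^sub>F t in at_left 0. ennreal_powr (ennreal (csk_mean \<nu> (h t))) \<alpha> = ennreal (csk_mean \<mu> t)"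
      by eventually_elim (simp add: ennreal_powr_def h base.csk_mean_pos less_imp_le)
  qed
  then show "m_zero \<mu> = ennreal_powr (m_zero \<nu>) \<alpha>"
    using tendsto_unique[OF _ pow.csk_mean_at_left_0] by simp
qed

section \<open>The formulas for the pseudo-variance and the variance\<close>

text \<open>Supplies one value of \<open>M\<close> shared by both families, so that
  \<open>M - 1\<close> cancels when the two sides of each formula are compared.\<close>

lemma domain_of_means_powerD:
  assumes "m \<in> domain_of_means \<mu>"
  obtains t \<theta> where "t < 0" "\<theta> < 0" "csk_M \<mu> t = csk_M \<nu> \<theta>"
    "csk_mean \<mu> t = m" "csk_mean \<nu> \<theta> = m powr (1 / \<alpha>)" "0 < m"
proof -
  obtain t where t: "t < 0" "csk_mean \<mu> t = m" using pow.domain_of_meansD[OF assms] .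
  obtain \<theta> where \<theta>: "\<theta> < 0" "csk_M \<nu> \<theta> = csk_M \<mu> t" "csk_mean \<mu> t = csk_mean \<nu> \<theta> powr \<alpha>"
    using matching_parameter_inv[OF t(1)] by blast
  have "m powr (1 / \<alpha>) = csk_mean \<nu> \<theta>"
    using t \<theta> exponent_pos base.csk_mean_pos[OF \<theta>(1)] by (auto simp: powr_powr)
  then show ?thesis using that t \<theta> pow.csk_mean_pos[OF t(1)] by simp
qed

lemma pseudo_variance_power:
  assumes "m \<in> domain_of_means \<mu>"
  shows "pseudo_variance \<mu> m = m powr (2 - 2 / \<alpha>) * pseudo_variance \<nu> (m powr (1 / \<alpha>))"
proof -
  obtain t \<theta> where *: "t < 0" "\<theta> < 0" "csk_M \<mu> t = csk_M \<nu> \<theta>"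
    "csk_mean \<mu> t = m" "csk_mean \<nu> \<theta> = m powr (1 / \<alpha>)" "0 < m"
    using domain_of_means_powerD[OF assms] .
  have "m powr (2 - 2 / \<alpha>) * (m powr (1 / \<alpha>))\<^sup>2 = m powr (2 - 2 / \<alpha> + 1 / \<alpha> + 1 / \<alpha>)"
    by (simp only: powr_add power2_eq_square mult.assoc)
  also have "\<dots> = m\<^sup>2" using *(6) by simp
  finally show ?thesis
    using pow.pseudo_variance_csk_mean[OF *(1)] base.pseudo_variance_csk_mean[OF *(2)] *
    by simp
qed

lemma m_zero_power_finite: "m_zero \<nu> < \<top> \<Longrightarrow> m_zero \<mu> = ennreal (enn2real (m_zero \<nu>) powr \<alpha>)"
  by (simp add: m_zero_power ennreal_powr_def)

lemma csk_variance_power: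
  assumes "m \<in> domain_of_means \<mu>" "m_zero \<nu> < \<top>"
  shows "csk_variance \<mu> m =
    (m - enn2real (m_zero \<nu>) powr \<alpha>) / (m powr (1 / \<alpha>) - enn2real (m_zero \<nu>))
    * m powr (1 - 1 / \<alpha>) * csk_variance \<nu> (m powr (1 / \<alpha>))"
proof -
  define m0 where "m0 = enn2real (m_zero \<nu>)"
  have \<mu>0: "m_zero \<mu> = ennreal (m0 powr \<alpha>)"
    using m_zero_power_finite[OF assms(2)] by (simp add: m0_def)
  obtain t \<theta> where *: "t < 0" "\<theta> < 0" "csk_M \<mu> t = csk_M \<nu> \<theta>"
    "csk_mean \<mu> t = m" "csk_mean \<nu> \<theta> = m powr (1 / \<alpha>)" "0 < m"
    using domain_of_means_powerD[OF assms(1)] .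
  have "m < m0 powr \<alpha>"
    using assms(1) *(6) by (simp add: domain_of_means_def \<mu>0 ennreal_less_iff)
  moreover have "(m powr (1 / \<alpha>)) powr \<alpha> = m" using exponent_pos *(6) by (simp add: powr_powr)
  \<comment> \<open>Equality would give \<open>m = m0 powr \<alpha>\<close>, but \<open>m\<close> is
    strictly below that upper end.\<close>
  ultimately have ne: "m powr (1 / \<alpha>) - m0 \<noteq> 0" by auto
  have "m powr (1 - 1 / \<alpha>) * m powr (1 / \<alpha>) = m"
    using *(6) by (simp flip: powr_add)
  then have "(m - m0 powr \<alpha>) / (m powr (1 / \<alpha>) - m0) * m powr (1 - 1 / \<alpha>)
      * (m powr (1 / \<alpha>) * (m powr (1 / \<alpha>) - m0) / (csk_M \<nu> \<theta> - 1))
    = m * (m - m0 powr \<alpha>) / (csk_M \<nu> \<theta> - 1)"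
    using ne by simp
  moreover have "csk_variance \<mu> m = m * (m - m0 powr \<alpha>) / (csk_M \<nu> \<theta> - 1)"
    using pow.csk_variance_csk_mean[OF *(1)] *(3,4) by (simp add: \<mu>0)
  moreover have "csk_variance \<nu> (m powr (1 / \<alpha>)) = m powr (1 / \<alpha>) * (m powr (1 / \<alpha>) - m0) / (csk_M \<nu> \<theta> - 1)"
    using base.csk_variance_csk_mean[OF *(2) assms(2)] *(5) by (simp add: m0_def)
  ultimately show ?thesis by (simp only: m0_def)
qed

end

theorem theorem2p4:
  fixes \<nu> \<nu>\<alpha> :: "real measure" and \<alpha> :: real
  assumes "nondeg_prob_nonneg \<nu>"
    and "\<alpha> > 0"
    and "is_free_mult_power \<nu> \<alpha> \<nu>\<alpha>"
  shows "m_minus \<nu>\<alpha> = m_minus \<nu> powr \<alpha> \<and>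
         m_zero \<nu>\<alpha> = ennreal_powr (m_zero \<nu>) \<alpha> \<and>
         (\<forall>m\<in>domain_of_means \<nu>\<alpha>.
            pseudo_variance \<nu>\<alpha> m = m powr (2 - 2 / \<alpha>) * pseudo_variance \<nu> (m powr (1 / \<alpha>))) \<and>
         (m_zero \<nu> < \<top> \<longrightarrow>
            csk_variance_exists \<nu> \<and> csk_variance_exists \<nu>\<alpha> \<and>
            (\<forall>m\<in>domain_of_means \<nu>\<alpha>.
               csk_variance \<nu>\<alpha> m =
                 (m - enn2real (m_zero \<nu>) powr \<alpha>) / (m powr (1 / \<alpha>) - enn2real (m_zero \<nu>))
                 * m powr (1 - 1 / \<alpha>) * csk_variance \<nu> (m powr (1 / \<alpha>))))"
proof -
  interpret free_mult_power \<nu> \<nu>\<alpha> \<alpha>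
    using nondeg_lawI[OF assms(1)] assms(2,3)
    by (auto simp: free_mult_power_def free_mult_power_axioms_def)
  \<comment> \<open>\<open>m_zero_power_finite\<close> makes the mean of the power finite, as the
    existence of its variance function requires.\<close>
  show ?thesis
    using m_minus_power m_zero_power pseudo_variance_power csk_variance_power m_zero_power_finite
      base.csk_variance_exists_if_finite_mean pow.csk_variance_exists_if_finite_mean
    by simp
qed

end
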